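(* Let $K, L \subset \mathbb{R}^d$ be convex bodies containing the origin in their interiors with $K \subseteq L$, let $F$ be a linear subspace of $\mathbb{R}^d$, and assume that $K$ is a largest-volume member of $\mathcal{A}_F(K)$ contained in $L$. Suppose in addition that $P_F K\subset L\cap F$. Then there exists a vector $z$ in the relative interior of $P_F K$ such that \[ P_F(K-z)\subset (L-z)\cap F\subset -d\cdot P_F(K-z). \] In particular, such a vector $z$ exists whenever $K$ is symmetric with respect to $F$ (i.e. invariant under the reflection $x\mapsto P_Fx-P_{F^\perp}x$).
   Context: A convex body is a compact convex set with nonempty interior. For a linear subspace $F\subseteq\mathbb{R}^d$, an $F$-operator is an invertible linear operator $A$ on $\mathbb{R}^d$ such that $F$ and $F^\perp$ are invariant subspaces of $A$ and the restriction of $A$ to $F^\perp$ is a nonzero multiple of the identity on $F^\perp$. For $S\subseteq\mathbb{R}^d$, $\mathcal{A}_F(S)=\{AS+z:\ A \text{ an } F\text{-operator},\ z\in\mathbb{R}^d\}$. $P_F$ denotes orthogonal projection onto $F$. *)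

theory Defs
  imports "HOL-Analysis.Analysis"
begin

definition convex_body :: "'a::euclidean_space set \<Rightarrow> bool" where
  "convex_body K \<longleftrightarrow> compact K \<and> convex K \<and> interior K \<noteq> {}"

definition proj_onto :: "'a::euclidean_space set \<Rightarrow> 'a \<Rightarrow> 'a" where
  "proj_onto F x = (THE y. y \<in> F \<and> x - y \<in> orthogonal_comp F)"

definition F_operator :: "'a::euclidean_space set \<Rightarrow> ('a \<Rightarrow> 'a) \<Rightarrow> bool" where
  "F_operator F A \<longleftrightarrow> linear A \<and> bij A \<and> A ` F \<subseteq> F
     \<and> A ` (orthogonal_comp F) \<subseteq> orthogonal_comp F
     \<and> (\<exists>c::real. c \<noteq> 0 \<and> (\<forall>x\<in>orthogonal_comp F. A x = c *\<^sub>R x))"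

definition affine_F_images :: "'a::euclidean_space set \<Rightarrow> 'a set \<Rightarrow> 'a set set" where
  "affine_F_images F S = {(\<lambda>x. A x + z) ` S | A z. F_operator F A}"

end

(* Put d = DIM('a), Q = P_F K and L_F = L \<inter> F.  It suffices to find u with u - x/d \<in> Q for all
   x \<in> L_F, because then z = d/(d+1) u works.  If no such u exists, Hahn-Banach yields finitely many
   v_i, x_i \<in> L_F, weights a_i \<ge> 0 and bounds h_i \<ge> max_Q v_i with \<Sum> a_i v_i = 0 and
   d S + \<Sum> a_i (v_i \<bullet> x_i) < 0, where S = \<Sum> a_i h_i.  For small e > 0 the affine map
   y \<mapsto> (1 - e S) y + e \<Sum> a_i (h_i - v_i \<bullet> P_F y) x_i sends each y \<in> K to a convex combination
   of y and the x_i, hence maps K into L.  Its linear part is an F-operator whose determinant has the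
   positive derivative - d S - \<Sum> a_i (v_i \<bullet> x_i) at e = 0, contradicting maximality of the volume.
   This replaces the usual John decomposition at contact points. *)
theory Submission
  imports Defs
begin

section \<open>Volume of linear images in a Euclidean space\<close>

text \<open>The library relates \<^const>\<open>det\<close> to volume only for \<^typ>\<open>real ^ 'n\<close> with a well-ordered
  index type; indexing by the basis of \<^typ>\<open>'a::euclidean_space\<close> transfers this to any Euclidean space.\<close>

typedef (overloaded) 'a basis_index = "Basis :: 'a::euclidean_space set"
  by (simp add: ex_in_conv)

lemma bij_betw_Rep_basis_index: "bij_betw Rep_basis_index UNIV (Basis :: 'a::euclidean_space set)"
  using type_definition.Rep_range[OF type_definition_basis_index]
  by (simp add: bij_betw_def inj_def Rep_basis_index_inject)

instance basis_index :: (euclidean_space) finite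
proof
  show "finite (UNIV :: 'a basis_index set)"
    using bij_betw_finite[OF bij_betw_Rep_basis_index] by simp
qed

text \<open>The order is arbitrary: any injection into the naturals pulls back a well-order, and
  nothing later depends on the choice.\<close>

definition basis_rank :: "'a::euclidean_space basis_index \<Rightarrow> nat" where
  "basis_rank = (SOME f. inj f)"

instantiation basis_index :: (euclidean_space) wellorder
begin

definition less_eq_basis_index :: "'a basis_index \<Rightarrow> 'a basis_index \<Rightarrow> bool" where
  "i \<le> j \<longleftrightarrow> basis_rank i \<le> basis_rank j"

definition less_basis_index :: "'a basis_index \<Rightarrow> 'a basis_index \<Rightarrow> bool" where
  "i < j \<longleftrightarrow> basis_rank i < basis_rank j"

instance
proof
  have "\<exists>f :: 'a basis_index \<Rightarrow> nat. inj f"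
    using finite_imp_inj_to_nat_seg[OF finite_class.finite_UNIV] by blast
  then have inj: "inj (basis_rank :: 'a basis_index \<Rightarrow> nat)"
    unfolding basis_rank_def by (rule someI_ex)
  show "i = j" if "i \<le> j" "j \<le> i" for i j :: "'a basis_index"
    using that inj by (simp add: less_eq_basis_index_def inj_eq)
  fix P :: "'a basis_index \<Rightarrow> bool" and i
  assume step: "\<And>i. (\<And>j. j < i \<Longrightarrow> P j) \<Longrightarrow> P i"
  show "P i"
    by (induction i rule: measure_induct_rule[of basis_rank]) (rule step, simp add: less_basis_index_def)
qed (auto simp: less_eq_basis_index_def less_basis_index_def)

end

section \<open>Coordinates with respect to the standard basis\<close>

definition to_vec :: "'a::euclidean_space \<Rightarrow> real ^ 'a basis_index" where
  "to_vec x = (\<chi> i. x \<bullet> Rep_basis_index i)"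

definition of_vec :: "real ^ 'a basis_index \<Rightarrow> 'a::euclidean_space" where
  "of_vec v = (\<Sum>i\<in>UNIV. v $ i *\<^sub>R Rep_basis_index i)"

lemma Rep_basis_index_in_Basis [simp]: "Rep_basis_index i \<in> Basis"
  by (rule Rep_basis_index)

lemma linear_to_vec: "linear to_vec"
  by (rule linearI) (simp_all add: to_vec_def vec_eq_iff inner_simps)

lemma linear_of_vec: "linear of_vec"
  by (rule linearI) (simp_all add: of_vec_def scaleR_sum_right sum.distrib scaleR_left_distrib)

lemma of_vec_inner_Rep: "of_vec v \<bullet> Rep_basis_index i = v $ i"
proof -
  have "of_vec v \<bullet> Rep_basis_index i = (\<Sum>j\<in>UNIV. v $ j * (if j = i then 1 else 0))"
    unfolding of_vec_def inner_sum_left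
    by (intro sum.cong) (auto simp: inner_Basis Rep_basis_index_inject)
  then show ?thesis by (simp add: if_distrib cong: if_cong)
qed

lemma to_vec_of_vec [simp]: "to_vec (of_vec v) = v"
  by (simp add: to_vec_def of_vec_inner_Rep vec_eq_iff)

lemma of_vec_to_vec [simp]: "of_vec (to_vec x) = x"
proof -
  have "of_vec (to_vec x) = (\<Sum>b\<in>Basis. (x \<bullet> b) *\<^sub>R b)"
    unfolding of_vec_def to_vec_def
    using sum.reindex_bij_betw[OF bij_betw_Rep_basis_index, of "\<lambda>b. (x \<bullet> b) *\<^sub>R b"] by simp
  then show ?thesis by (simp add: euclidean_representation)
qed

lemma of_vec_axis: "of_vec (axis i 1) = Rep_basis_index i"
  unfolding of_vec_def axis_def by (simp add: if_distrib[of "\<lambda>c. c *\<^sub>R _"] cong: if_cong)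

section \<open>Lebesgue measure in coordinates\<close>

lemma compact_linear_image:
  fixes f :: "'a::euclidean_space \<Rightarrow> 'b::euclidean_space"
  shows "linear f \<Longrightarrow> compact S \<Longrightarrow> compact (f ` S)"
  by (simp add: compact_continuous_image linear_continuous_on linear_conv_bounded_linear)

lemma borel_measurable_of_vec: "of_vec \<in> borel_measurable borel"
  using linear_of_vec
  by (intro borel_measurable_continuous_onI linear_continuous_on) (simp add: linear_conv_bounded_linear)

text \<open>Lebesgue measure is determined by its values on boxes, and \<open>of_vec\<close> pulls a
  box back to a box with the same side lengths.\<close>

lemma lborel_eq_distr_of_vec: "(lborel :: 'a::euclidean_space measure) = distr lborel borel of_vec"
proof (rule lborel_eqI)
  fix l u :: 'a
  assume le: "\<And>b. b \<in> Basis \<Longrightarrow> l \<bullet> b \<le> u \<bullet> b"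
  have eq: "of_vec -` box l u = box (to_vec l) (to_vec u)"
  proof -
    have range: "(Basis :: 'a set) = range Rep_basis_index"
      by (rule bij_betw_imp_surj_on[OF bij_betw_Rep_basis_index, symmetric])
    have "v \<in> of_vec -` box l u \<longleftrightarrow>
        (\<forall>i. l \<bullet> Rep_basis_index i < v $ i \<and> v $ i < u \<bullet> Rep_basis_index i)" for v
      unfolding vimage_eq mem_box range by (simp add: of_vec_inner_Rep)
    then show ?thesis
      by (auto simp: mem_box_cart to_vec_def)
  qed
  have "emeasure (distr lborel borel of_vec) (box l u) = emeasure lborel (box (to_vec l) (to_vec u))"
    by (simp add: emeasure_distr borel_measurable_of_vec eq)
  also have "\<dots> = (\<Prod>b\<in>Basis. (to_vec u - to_vec l) \<bullet> b)"
    using le by (intro emeasure_lborel_box) (auto simp: Basis_vec_def inner_axis to_vec_def)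
  also have "(\<Prod>b\<in>Basis. (to_vec u - to_vec l) \<bullet> b) = (\<Prod>i\<in>UNIV. (u - l) \<bullet> Rep_basis_index i)"
  proof -
    have "inj (\<lambda>i :: 'a basis_index. axis i (1::real))"
      by (auto simp: inj_def axis_eq_axis)
    moreover have "(Basis :: (real ^ 'a basis_index) set) = range (\<lambda>i. axis i 1)"
      by (auto simp: Basis_vec_def)
    ultimately have "bij_betw (\<lambda>i. axis i 1) UNIV (Basis :: (real ^ 'a basis_index) set)"
      by (simp add: bij_betw_def)
    from prod.reindex_bij_betw[OF this, of "\<lambda>b. (to_vec u - to_vec l) \<bullet> b", symmetric]
    show ?thesis
      by (simp add: inner_axis to_vec_def inner_diff_left)
  qed
  also have "\<dots> = (\<Prod>b\<in>Basis. (u - l) \<bullet> b)"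
    using prod.reindex_bij_betw[OF bij_betw_Rep_basis_index, of "\<lambda>b. (u - l) \<bullet> b"] by simp
  finally show "emeasure (distr lborel borel of_vec) (box l u) = (\<Prod>b\<in>Basis. (u - l) \<bullet> b)" .
qed simp

text \<open>As \<open>of_vec\<close> inverts \<open>to_vec\<close>, the image under
  \<open>to_vec\<close> is the preimage under the measure-preserving \<open>of_vec\<close>.
  Compactness makes both sets Borel.\<close>

lemma measure_to_vec_image:
  fixes S :: "'a::euclidean_space set"
  assumes "compact S"
  shows "measure lebesgue (to_vec ` S) = measure lebesgue S"
proof -
  have S: "S \<in> sets borel"
    using assms by (simp add: compact_imp_closed)
  have "compact (to_vec ` S)"
    using assms linear_to_vec by (intro compact_linear_image)
  then have S': "to_vec ` S \<in> sets borel"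
    by (simp add: compact_imp_closed)
  have eq: "of_vec -` S = to_vec ` S"
    by (auto simp: image_iff) (metis to_vec_of_vec)
  have "measure lborel S = measure lborel (to_vec ` S)"
    by (subst lborel_eq_distr_of_vec) (use S in \<open>simp add: measure_distr borel_measurable_of_vec eq\<close>)
  then show ?thesis
    using S S' by simp
qed

lemma linear_to_vec_of_vec:
  "linear f \<Longrightarrow> linear (to_vec \<circ> f \<circ> of_vec)"
  by (rule linear_compose[OF linear_of_vec linear_compose[OF _ linear_to_vec]])

lemma measure_linear_image_compact:
  fixes f :: "'a::euclidean_space \<Rightarrow> 'a"
  assumes "linear f" "compact S"
  shows "measure lebesgue (f ` S)
    = \<bar>det (matrix (to_vec \<circ> f \<circ> of_vec))\<bar> * measure lebesgue S"
proof -
  have "measure lebesgue (f ` S) = measure lebesgue (to_vec ` f ` S)"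
    using assms by (intro measure_to_vec_image[symmetric] compact_linear_image)
  also have "to_vec ` f ` S = (to_vec \<circ> f \<circ> of_vec) ` to_vec ` S"
    by (simp add: image_comp o_def)
  also have "measure lebesgue \<dots> = \<bar>det (matrix (to_vec \<circ> f \<circ> of_vec))\<bar> * measure lebesgue (to_vec ` S)"
    using assms
    by (intro measure_linear_image linear_to_vec_of_vec lmeasurable_compact
        compact_linear_image[OF linear_to_vec])
  finally show ?thesis
    using assms by (simp add: measure_to_vec_image)
qed

section \<open>First-order change of determinant and volume\<close>

text \<open>The Leibniz expansion is differentiated term by term; at the identity matrix only the
  identity permutation contributes.\<close>

lemma has_real_derivative_det_line:
  fixes N :: "real ^ 'n ^ 'n"
  shows "((\<lambda>e. det (mat 1 + e *\<^sub>R N)) has_real_derivative trace N) (at 0)"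
proof -
  let ?P = "{p. p permutes (UNIV :: 'n set)}"
  let ?D = "\<lambda>p. \<Sum>i\<in>UNIV. N $ i $ p i * (\<Prod>j\<in>UNIV - {i}. if j = p j then 1 else 0)"
  have deriv: "((\<lambda>e. det (mat 1 + e *\<^sub>R N)) has_real_derivative (\<Sum>p\<in>?P. of_int (sign p) * ?D p)) (at 0)"
    unfolding det_def
  proof (rule DERIV_sum, rule DERIV_cmult)
    fix p :: "'n \<Rightarrow> 'n"
    have "((\<lambda>e. (mat 1 + e *\<^sub>R N) $ i $ p i) has_real_derivative N $ i $ p i) (at 0)" for i
      by (auto intro!: derivative_eq_intros)
    from has_field_derivative_prod[where A = UNIV, OF this]
    show "((\<lambda>e. \<Prod>i\<in>UNIV. (mat 1 + e *\<^sub>R N) $ i $ p i) has_real_derivative ?D p) (at 0)"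
      by (simp add: mat_def)
  qed
  have D: "?D p = (if p = id then trace N else 0)" if "p \<in> ?P" for p
  proof (cases "p = id")
    case True
    then show ?thesis by (simp add: trace_def)
  next
    case False
    then obtain k where k: "p k \<noteq> k" by fastforce
    \<comment> \<open>Both \<open>k\<close> and \<open>p k\<close> are moved by \<open>p\<close>, so
      whichever single index is left out of the product, a zero factor remains.\<close>
    have "p (p k) \<noteq> p k"
      using k that by (metis mem_Collect_eq permutes_inj injD)
    have "(\<Prod>j\<in>UNIV - {i}. if j = p j then 1 else (0::real)) = 0" for i
    proof (cases "i = k")
      case True
      with k \<open>p (p k) \<noteq> p k\<close> show ?thesis by (intro prod_zero bexI[of _ "p k"]) auto
    next
      case False
      with k show ?thesis by (intro prod_zero bexI[of _ k]) auto
    qed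
    then have "?D p = 0"
      by (simp only: mult_zero_right sum.neutral_const)
    with False show ?thesis by simp
  qed
  have "(\<Sum>p\<in>?P. of_int (sign p) * ?D p) = (\<Sum>p\<in>?P. if p = id then trace N else 0)"
    by (intro sum.cong refl) (simp only: D, simp)
  also have "\<dots> = trace N"
    by (simp add: sum.delta finite_permutations permutes_id)
  finally show ?thesis
    using deriv by (simp only:)
qed

text \<open>The sum over \<open>Basis\<close> is the trace of \<open>N\<close>, the derivative at 0
  of a determinant that starts at 1. Just to the right of 0 the determinant therefore exceeds 1,
  which gives both injectivity and volume growth.\<close>

lemma eventually_volume_increasing:
  fixes N :: "'a::euclidean_space \<Rightarrow> 'a"
  assumes "linear N" and "(\<Sum>b\<in>Basis. N b \<bullet> b) > 0"
    and "compact S" and "measure lebesgue S > 0"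
  shows "\<forall>\<^sub>F e in at_right 0. inj (\<lambda>x. x + e *\<^sub>R N x) \<and>
           measure lebesgue S < measure lebesgue ((\<lambda>x. x + e *\<^sub>R N x) ` S)"
proof -
  define M where "M = matrix (to_vec \<circ> N \<circ> of_vec)"
  have lin: "linear (\<lambda>x. x + e *\<^sub>R N x)" for e
    using assms(1) by (intro linear_compose_add linear_compose_scale_right) (auto intro: linear_ident)
  have mat: "matrix (to_vec \<circ> (\<lambda>x. x + e *\<^sub>R N x) \<circ> of_vec) = mat 1 + e *\<^sub>R M" for e
    unfolding M_def matrix_def
    by (simp add: vec_eq_iff linear_add[OF linear_to_vec] linear_scale[OF linear_to_vec] mat_def axis_def)
  have "trace M = (\<Sum>i\<in>UNIV. N (Rep_basis_index i) \<bullet> Rep_basis_index i)"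
    by (simp add: M_def trace_def matrix_def of_vec_axis to_vec_def)
  also have "\<dots> = (\<Sum>b\<in>Basis. N b \<bullet> b)"
    using sum.reindex_bij_betw[OF bij_betw_Rep_basis_index, of "\<lambda>b. N b \<bullet> b"] by simp
  finally have "trace M > 0" using assms(2) by simp
  then obtain d where d: "d > 0" "\<And>h. 0 < h \<Longrightarrow> h < d \<Longrightarrow> det (mat 1 + 0 *\<^sub>R M) < det (mat 1 + (0 + h) *\<^sub>R M)"
    using DERIV_pos_inc_right[OF has_real_derivative_det_line] by metis
  have "inj (\<lambda>x. x + e *\<^sub>R N x) \<and> measure lebesgue S < measure lebesgue ((\<lambda>x. x + e *\<^sub>R N x) ` S)"
    if "0 < e" "e < d" for e
  proof
    let ?f = "\<lambda>x. x + e *\<^sub>R N x"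
    have det: "1 < det (matrix (to_vec \<circ> ?f \<circ> of_vec))"
      using d(2)[OF that] by (simp add: mat)
    then show "measure lebesgue S < measure lebesgue (?f ` S)"
      using assms(4) by (simp add: measure_linear_image_compact[OF lin assms(3)])
    have "linear (to_vec \<circ> ?f \<circ> of_vec)"
      using lin by (rule linear_to_vec_of_vec)
    then have "inj (to_vec \<circ> ?f \<circ> of_vec)"
      using det det_nz_iff_inj by fastforce
    then show "inj ?f"
      unfolding inj_def comp_def by (metis of_vec_to_vec)
  qed
  then show ?thesis
    using d(1) unfolding eventually_at_right_field by blast
qed

section \<open>A duality certificate\<close>

text \<open>A Farkas-type alternative. A common \<open>u\<close> would satisfy
  \<open>v i \<bullet> u \<le> h i + v i \<bullet> x i\<close> for all \<open>i\<close>, and the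
  weighted sum of these would make the last sum nonnegative; the lemma is the converse. Indices are
  pairs because they are the points of \<open>G\<close> occurring in a convex combination.\<close>

lemma no_common_translate_certificate:
  fixes Q X :: "'a::euclidean_space set"
  assumes "closed Q" "convex Q" "bounded Q" "X \<noteq> {}"
    and no_translate: "\<nexists>u. \<forall>x\<in>X. u - x \<in> Q"
  obtains I :: "('a \<times> real) set" and a h :: "'a \<times> real \<Rightarrow> real" and v x :: "'a \<times> real \<Rightarrow> 'a"
  where "finite I" and "\<And>i. i \<in> I \<Longrightarrow> 0 \<le> a i" and "\<And>i. i \<in> I \<Longrightarrow> x i \<in> X"
    and "\<And>i q. i \<in> I \<Longrightarrow> q \<in> Q \<Longrightarrow> v i \<bullet> q \<le> h i"
    and "(\<Sum>i\<in>I. a i *\<^sub>R v i) = 0" and "(\<Sum>i\<in>I. a i * (h i + v i \<bullet> x i)) < 0"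
proof -
  \<comment> \<open>A pair \<open>(v, t)\<close> in \<open>G\<close> encodes a bound
    \<open>v \<bullet> u < t\<close> that every common translate \<open>u\<close> would satisfy. The
    origin in the convex hull means that finitely many such bounds combine to 0 < 0.\<close>
  define G where "G = {(v, t). \<exists>x\<in>X. \<exists>h. (\<forall>q\<in>Q. v \<bullet> q \<le> h) \<and> h + v \<bullet> x < t}"
  obtain x0 where x0: "x0 \<in> X" using \<open>X \<noteq> {}\<close> by blast
  have "0 \<in> convex hull G"
  proof (rule ccontr)
    assume "0 \<notin> convex hull G"
    then obtain c where "c \<noteq> 0" and c: "\<forall>g\<in>convex hull G. 0 \<le> c \<bullet> g"
      using separating_hyperplane_set_0[OF convex_convex_hull] by blast
    obtain w s where ws: "c = (w, s)" by (cases c)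
    have nonneg: "0 \<le> w \<bullet> v + s * t" if "x \<in> X" "\<And>q. q \<in> Q \<Longrightarrow> v \<bullet> q \<le> h" "h + v \<bullet> x < t" for v t x h
    proof -
      have "(v, t) \<in> G"
        using that unfolding G_def by blast
      then show ?thesis
        using bspec[OF c hull_inc] by (fastforce simp: ws inner_prod_def)
    qed
    have "0 \<le> s"
      using nonneg[of x0 0 0 1] x0 by simp
    \<comment> \<open>Boundedness of \<open>Q\<close> supplies an upper bound in every direction, in
      particular for \<open>v = - w\<close>; with \<open>s = 0\<close> this forces
      \<open>w = 0\<close>.\<close>
    have "s \<noteq> 0"
    proof
      assume "s = 0"
      obtain B where B: "\<And>q. q \<in> Q \<Longrightarrow> norm q \<le> B"
        using \<open>bounded Q\<close> by (auto simp: bounded_iff)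
      have "- w \<bullet> q \<le> norm w * B" if "q \<in> Q" for q
        using norm_cauchy_schwarz[of "- w" q] mult_left_mono[OF B[OF that], of "norm w"] by simp
      from nonneg[OF x0 this, of "norm w * B + - w \<bullet> x0 + 1"] have "w \<bullet> w \<le> 0"
        by (simp add: \<open>s = 0\<close>)
      then have "w = 0"
        by (metis inner_gt_zero_iff not_less)
      with \<open>s = 0\<close> \<open>c \<noteq> 0\<close> ws show False by (simp add: zero_prod_def)
    qed
    \<comment> \<open>Dividing \<open>0 \<le> w \<bullet> v + s * t\<close> by \<open>s\<close>
      gives \<open>v \<bullet> u \<le> t\<close> on all of \<open>G\<close>, so this
      \<open>u\<close> is a common translate.\<close>
    define u where "u = - (1 / s) *\<^sub>R w"
    have "u - x \<in> Q" if "x \<in> X" for x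
    proof (rule ccontr)
      assume "u - x \<notin> Q"
      then obtain a b where ab: "a \<bullet> (u - x) < b" "\<And>q. q \<in> Q \<Longrightarrow> b < a \<bullet> q"
        using separating_hyperplane_closed_point[OF \<open>convex Q\<close> \<open>closed Q\<close>] by blast
      \<comment> \<open>With \<open>v = - a\<close> and \<open>h = - b\<close>, this is the midpoint
        of \<open>h + v \<bullet> x\<close> and \<open>v \<bullet> u\<close>: large enough for
        \<open>(v, t)\<close> to lie in \<open>G\<close>, yet below
        \<open>v \<bullet> u\<close>.\<close>
      define t where "t = (- b + - a \<bullet> x + - a \<bullet> u) / 2"
      have "0 \<le> w \<bullet> (- a) + s * t"
        using that ab by (intro nonneg[of x _ "- b"]) (auto simp: t_def inner_diff_right less_imp_le)
      moreover have "w = - s *\<^sub>R u"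
        using \<open>s \<noteq> 0\<close> by (simp add: u_def)
      ultimately have "0 \<le> s * (t + a \<bullet> u)"
        by (simp add: algebra_simps inner_commute)
      with \<open>0 \<le> s\<close> \<open>s \<noteq> 0\<close> have "0 \<le> t + a \<bullet> u"
        by (simp add: zero_le_mult_iff)
      then show False
        using ab(1) by (simp add: t_def inner_diff_right field_simps)
    qed
    with no_translate show False by blast
  qed
  then obtain I a where I: "finite I" "I \<subseteq> G" "\<forall>i\<in>I. 0 \<le> a i" "sum a I = 1" "(\<Sum>i\<in>I. a i *\<^sub>R i) = 0"
    unfolding convex_hull_explicit by blast
  have "\<forall>i\<in>I. \<exists>x h. x \<in> X \<and> (\<forall>q\<in>Q. fst i \<bullet> q \<le> h) \<and> h + fst i \<bullet> x < snd i"
    using I(2) unfolding G_def by fastforce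
  then obtain x h where xh: "\<And>i. i \<in> I \<Longrightarrow> x i \<in> X \<and> (\<forall>q\<in>Q. fst i \<bullet> q \<le> h i) \<and> h i + fst i \<bullet> x i < snd i"
    by metis
  \<comment> \<open>The strict inequality in \<open>G\<close> survives because weights with sum 1
    include a positive one.\<close>
  have "(\<Sum>i\<in>I. a i * (h i + fst i \<bullet> x i)) < (\<Sum>i\<in>I. a i * snd i)"
  proof (rule sum_strict_mono_ex1)
    show "\<forall>i\<in>I. a i * (h i + fst i \<bullet> x i) \<le> a i * snd i"
      using I(3) xh by (meson less_imp_le mult_left_mono)
    obtain j where "j \<in> I" "a j \<noteq> 0"
      using I(4) by (metis sum.neutral zero_neq_one)
    then have "0 < a j" "h j + fst j \<bullet> x j < snd j"
      using I(3) xh by (simp_all add: less_le)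
    with \<open>j \<in> I\<close> show "\<exists>i\<in>I. a i * (h i + fst i \<bullet> x i) < a i * snd i"
      using mult_strict_left_mono by blast
  qed (use I in simp)
  moreover have "(\<Sum>i\<in>I. a i * snd i) = 0"
    using arg_cong[OF I(5), of snd] by (simp add: snd_sum)
  moreover have "(\<Sum>i\<in>I. a i *\<^sub>R fst i) = 0"
    using arg_cong[OF I(5), of fst] by (simp add: fst_sum)
  ultimately show thesis
    using I(1,3) xh by (intro that[of I a x fst h]) (blast | simp)+
qed

text \<open>A convex combination in which \<open>y\<close> takes the leftover weight; the option
  type adjoins the index \<open>None\<close> for \<open>y\<close>.\<close>

lemma convex_shift_sum:
  assumes "convex L" "y \<in> L" "finite I" "\<And>i. i \<in> I \<Longrightarrow> 0 \<le> b i" "\<And>i. i \<in> I \<Longrightarrow> x i \<in> L"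
    and "sum b I \<le> 1"
  shows "(1 - sum b I) *\<^sub>R y + (\<Sum>i\<in>I. b i *\<^sub>R x i) \<in> L"
proof -
  let ?J = "insert None (Some ` I)"
  let ?c = "case_option (1 - sum b I) b" and ?z = "case_option y x"
  have "(\<Sum>j\<in>?J. ?c j *\<^sub>R ?z j) \<in> L"
    using assms by (intro convex_sum) (auto simp: sum.reindex)
  then show ?thesis
    using assms(3) by (simp add: sum.reindex)
qed

section \<open>The largest-volume position\<close>

context
  fixes F :: "'a::euclidean_space set"
  assumes F: "subspace F"
begin

text \<open>Two candidates differ by a vector lying both in \<open>F\<close> and in its orthogonal
  complement, hence by 0.\<close>

lemma proj_onto_unique:
  assumes "y \<in> F" "x - y \<in> orthogonal_comp F"
  shows "proj_onto F x = y"
  unfolding proj_onto_def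
proof (rule the_equality)
  fix y' assume y': "y' \<in> F \<and> x - y' \<in> orthogonal_comp F"
  have "y' - y \<in> F"
    using y' assms F by (simp add: subspace_diff)
  moreover have "y' - y \<in> orthogonal_comp F"
    using subspace_diff[OF subspace_orthogonal_comp assms(2) conjunct2[OF y']] by simp
  ultimately show "y' = y"
    by (auto simp: orthogonal_comp_def orthogonal_def)
qed (use assms in simp)

lemma proj_onto_mem: "proj_onto F x \<in> F"
  and diff_proj_onto_mem: "x - proj_onto F x \<in> orthogonal_comp F"
proof -
  obtain y z where "y \<in> span F" "\<And>w. w \<in> span F \<Longrightarrow> orthogonal z w" "x = y + z"
    using orthogonal_subspace_decomp_exists by blast
  then have *: "y \<in> F" "x - y \<in> orthogonal_comp F"
    using F by (auto simp: orthogonal_comp_def orthogonal_commute span_eq_iff[THEN iffD2])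
  with proj_onto_unique show "proj_onto F x \<in> F" "x - proj_onto F x \<in> orthogonal_comp F"
    by simp_all
qed

lemma linear_proj_onto: "linear (proj_onto F)"
proof (rule linearI)
  fix x y :: 'a and c :: real
  show "proj_onto F (x + y) = proj_onto F x + proj_onto F y"
    using subspace_add[OF subspace_orthogonal_comp diff_proj_onto_mem[of x] diff_proj_onto_mem[of y]]
    by (intro proj_onto_unique) (auto simp: F subspace_add proj_onto_mem algebra_simps)
  show "proj_onto F (c *\<^sub>R x) = c *\<^sub>R proj_onto F x"
    using subspace_scale[OF subspace_orthogonal_comp diff_proj_onto_mem[of x], of c]
    by (intro proj_onto_unique) (auto simp: F subspace_scale proj_onto_mem algebra_simps)
qed

lemma proj_onto_eq_self: "x \<in> F \<Longrightarrow> proj_onto F x = x"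
  by (rule proj_onto_unique) (auto simp: subspace_0 subspace_orthogonal_comp)

lemma proj_onto_eq_0: "x \<in> orthogonal_comp F \<Longrightarrow> proj_onto F x = 0"
  by (rule proj_onto_unique) (auto simp: F subspace_0)

section \<open>First-order optimality of the largest-volume position\<close>

lemma exists_translate_of_largest_volume:
  assumes K: "convex_body K" and L: "convex L" and "0 \<in> K" "K \<subseteq> L"
    and max: "\<forall>K' \<in> affine_F_images F K. K' \<subseteq> L \<longrightarrow> measure lebesgue K' \<le> measure lebesgue K"
  shows "\<exists>u. \<forall>x\<in>L \<inter> F. u - (1 / real DIM('a)) *\<^sub>R x \<in> proj_onto F ` K"
proof (rule ccontr)
  let ?P = "proj_onto F" and ?d = "real DIM('a)"
  assume "\<not> ?thesis"
  then have no: "\<nexists>u. \<forall>x\<in>(\<lambda>x. (1 / ?d) *\<^sub>R x) ` (L \<inter> F). u - x \<in> ?P ` K"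
    by simp
  have "compact K" "convex K"
    using K by (auto simp: convex_body_def)
  then have cpt: "compact (?P ` K)" and cvx: "convex (?P ` K)"
    by (auto intro: compact_linear_image convex_linear_image linear_proj_onto)
  have ne: "(\<lambda>x. (1 / ?d) *\<^sub>R x) ` (L \<inter> F) \<noteq> {}"
    using \<open>0 \<in> K\<close> \<open>K \<subseteq> L\<close> F subspace_0 by blast
  obtain I :: "('a \<times> real) set" and a h v x
    where I: "finite I" and a: "\<And>i. i \<in> I \<Longrightarrow> 0 \<le> a i"
      and x: "\<And>i. i \<in> I \<Longrightarrow> x i \<in> (\<lambda>x. (1 / ?d) *\<^sub>R x) ` (L \<inter> F)"
      and h: "\<And>i q. i \<in> I \<Longrightarrow> q \<in> ?P ` K \<Longrightarrow> v i \<bullet> q \<le> h i"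
      and av: "(\<Sum>i\<in>I. a i *\<^sub>R v i) = 0" and neg: "(\<Sum>i\<in>I. a i * (h i + v i \<bullet> x i)) < 0"
    by (rule no_common_translate_certificate[OF compact_imp_closed[OF cpt] cvx compact_imp_bounded[OF cpt] ne no],
        rule that)
  define y where "y i = ?d *\<^sub>R x i" for i
  have y: "y i \<in> L \<inter> F" if "i \<in> I" for i
    using x[OF that] by (auto simp: y_def)
  \<comment> \<open>By the identity \<open>weight\<close> below, \<open>N z + w\<close> equals the
    sum of \<open>a i * (h i - v i \<bullet> ?P z)\<close> times \<open>y i - z\<close>. Points of
    \<open>K\<close> are thus pushed towards the \<open>y i\<close> at nonnegative rates of total
    \<open>S\<close>; \<open>N\<close> is the linear part of this velocity and \<open>w\<close> the
    constant part.\<close>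
  define S where "S = (\<Sum>i\<in>I. a i * h i)"
  define B where "B z = (\<Sum>i\<in>I. (a i * (v i \<bullet> ?P z)) *\<^sub>R y i)" for z
  define w where "w = (\<Sum>i\<in>I. (a i * h i) *\<^sub>R y i)"
  define N where "N z = - S *\<^sub>R z - B z" for z
  have "linear B"
    unfolding B_def
    by (rule linearI)
       (simp_all add: linear_add[OF linear_proj_onto] linear_scale[OF linear_proj_onto] inner_add_right
          algebra_simps sum.distrib scaleR_sum_right)
  then have "linear N"
    unfolding N_def by (intro linear_compose_sub linear_compose_scale_right linear_ident)
  \<comment> \<open>Each summand of \<open>B\<close> is a rank-one map with trace
    \<open>a i * (v i \<bullet> ?P (y i))\<close>, and \<open>?P\<close> fixes
    \<open>y i\<close>.\<close>
  have trB: "(\<Sum>b\<in>Basis. B b \<bullet> b) = (\<Sum>i\<in>I. a i * (v i \<bullet> y i))"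
  proof -
    have "(\<Sum>b\<in>Basis. B b \<bullet> b) = (\<Sum>i\<in>I. \<Sum>b\<in>Basis. a i * (v i \<bullet> ?P b) * (y i \<bullet> b))"
      unfolding B_def inner_sum_left by (subst sum.swap) simp
    also have "\<dots> = (\<Sum>i\<in>I. a i * (v i \<bullet> ?P (\<Sum>b\<in>Basis. (y i \<bullet> b) *\<^sub>R b)))"
      by (simp add: linear_sum[OF linear_proj_onto] linear_scale[OF linear_proj_onto]
          inner_sum_right sum_distrib_left mult_ac)
    also have "\<dots> = (\<Sum>i\<in>I. a i * (v i \<bullet> y i))"
      using y by (simp add: euclidean_representation proj_onto_eq_self)
    finally show ?thesis .
  qed
  have "(\<Sum>b\<in>Basis. N b \<bullet> b) = - (?d * S) - (\<Sum>b\<in>Basis. B b \<bullet> b)"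
    by (simp add: N_def inner_diff_left sum_subtractf sum_negf)
  \<comment> \<open>The scaling by \<open>1 / ?d\<close> pays off here: since
    \<open>y i = ?d *\<^sub>R x i\<close>, the trace is exactly \<open>- ?d\<close> times the
    negative sum of the certificate.\<close>
  also have "\<dots> = - (?d * (\<Sum>i\<in>I. a i * (h i + v i \<bullet> x i)))"
    unfolding trB S_def y_def by (simp add: algebra_simps sum.distrib sum_distrib_left)
  finally have trN: "(\<Sum>b\<in>Basis. N b \<bullet> b) > 0"
    using neg by (simp add: mult_pos_neg)
  have "\<not> negligible K"
    using K open_not_negligible[OF open_interior] negligible_subset[OF _ interior_subset]
    by (auto simp: convex_body_def)
  then have "measure lebesgue K > 0"
    using negligible_iff_measure0[OF lmeasurable_compact[OF \<open>compact K\<close>]]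
    by (simp add: less_le)
  \<comment> \<open>The dependence on \<open>k\<close> cancels because the weighted
    \<open>v i\<close> sum to zero.\<close>
  have weight: "(\<Sum>i\<in>I. a i * (h i - v i \<bullet> ?P k)) = S" for k
  proof -
    have "(\<Sum>i\<in>I. a i * (v i \<bullet> ?P k)) = (\<Sum>i\<in>I. a i *\<^sub>R v i) \<bullet> ?P k"
      by (simp add: inner_sum_left)
    then show ?thesis
      by (simp add: av S_def right_diff_distrib sum_subtractf)
  qed
  have weight_nonneg: "0 \<le> a i * (h i - v i \<bullet> ?P k)" if "i \<in> I" "k \<in> K" for i k
    using a[OF that(1)] h[OF that(1), of "?P k"] that(2) by simp
  have "0 \<le> S"
    unfolding weight[of 0, symmetric] by (intro sum_nonneg weight_nonneg \<open>0 \<in> K\<close>)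
  \<comment> \<open>This bound yields \<open>e * S < 1\<close>; the added 1 covers the case
    \<open>S = 0\<close>.\<close>
  have "\<forall>\<^sub>F e in at_right 0. e < 1 / (S + 1)"
    using \<open>0 \<le> S\<close> by (intro eventually_at_right_less order_tendstoD) auto
  moreover have "\<forall>\<^sub>F e::real in at_right 0. 0 < e"
    by (rule eventually_at_right_less)
  ultimately have "\<forall>\<^sub>F e in at_right 0. 0 < e \<and> e < 1 / (S + 1) \<and> inj (\<lambda>z. z + e *\<^sub>R N z) \<and>
      measure lebesgue K < measure lebesgue ((\<lambda>z. z + e *\<^sub>R N z) ` K)"
    using eventually_volume_increasing[OF \<open>linear N\<close> trN \<open>compact K\<close> \<open>measure lebesgue K > 0\<close>]
    by eventually_elim blast
  then obtain e where e: "0 < e" "e < 1 / (S + 1)" "inj (\<lambda>z. z + e *\<^sub>R N z)"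
    and vol: "measure lebesgue K < measure lebesgue ((\<lambda>z. z + e *\<^sub>R N z) ` K)"
    using eventually_happens'[OF trivial_limit_at_right_real] by blast
  have eS: "e * S < 1"
    using e \<open>0 \<le> S\<close> by (simp add: field_simps)
  let ?A = "\<lambda>z. z + e *\<^sub>R N z" and ?t = "e *\<^sub>R w"
  have linA: "linear ?A"
    using \<open>linear N\<close> by (intro linear_compose_add linear_compose_scale_right linear_ident)
  have BF: "B z \<in> F" for z
    unfolding B_def using y F by (intro subspace_sum) (auto intro: subspace_scale)
  \<comment> \<open>\<open>B\<close> takes values in \<open>F\<close> and vanishes on the orthogonal
    complement, where \<open>?A\<close> is therefore multiplication by
    \<open>1 - e * S\<close>.\<close>
  have "F_operator F ?A"
    unfolding F_operator_def
  proof (intro conjI exI ballI)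
    show "linear ?A" by (rule linA)
    show "bij ?A"
      using linA e(3) by (simp add: bij_def linear_injective_imp_surjective)
    show "?A ` F \<subseteq> F"
      unfolding N_def using F BF by (auto intro!: subspace_add subspace_diff subspace_neg subspace_scale)
    show "1 - e * S \<noteq> 0" using eS by simp
    show scale: "?A z = (1 - e * S) *\<^sub>R z" if "z \<in> orthogonal_comp F" for z
      using that by (simp add: N_def B_def proj_onto_eq_0 algebra_simps)
    show "?A ` orthogonal_comp F \<subseteq> orthogonal_comp F"
      using scale by (auto simp: subspace_orthogonal_comp subspace_scale)
  qed
  then have "(\<lambda>z. ?A z + ?t) ` K \<in> affine_F_images F K"
    unfolding affine_F_images_def by (intro CollectI exI[of _ ?A] exI[of _ ?t]) simp
  moreover have "(\<lambda>z. ?A z + ?t) ` K \<subseteq> L"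
  proof
    fix p assume "p \<in> (\<lambda>z. ?A z + ?t) ` K"
    then obtain k where k: "k \<in> K" "p = ?A k + ?t" by blast
    let ?b = "\<lambda>i. e * (a i * (h i - v i \<bullet> ?P k))"
    have sum: "sum ?b I = e * S"
      by (simp add: weight flip: sum_distrib_left)
    have "p = (1 - e * S) *\<^sub>R k + (\<Sum>i\<in>I. ?b i *\<^sub>R y i)"
      by (simp add: k N_def B_def w_def algebra_simps scaleR_sum_right sum_subtractf)
    also have "\<dots> = (1 - sum ?b I) *\<^sub>R k + (\<Sum>i\<in>I. ?b i *\<^sub>R y i)"
      by (simp only: sum)
    also have "\<dots> \<in> L"
    proof (rule convex_shift_sum[OF L _ I])
      show "k \<in> L" using k \<open>K \<subseteq> L\<close> by blast
      show "0 \<le> ?b i" if "i \<in> I" for i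
        using weight_nonneg[OF that k(1)] e(1) by simp
      show "y i \<in> L" if "i \<in> I" for i
        using y[OF that] by blast
      show "sum ?b I \<le> 1"
        using sum eS by simp
    qed
    finally show "p \<in> L" .
  qed
  moreover have "measure lebesgue ((\<lambda>z. ?A z + ?t) ` K) = measure lebesgue (?A ` K)"
    using measure_translation[of ?t "?A ` K"] by (simp add: image_image add.commute)
  ultimately show False
    using max vol by fastforce
qed

end

section \<open>From the translate to the two inclusions\<close>

theorem mainTheorem2:
  fixes K L F :: "'a::euclidean_space set"
  assumes "convex_body K" and "convex_body L"
    and "0 \<in> interior K" and "0 \<in> interior L"
    and "K \<subseteq> L"
    and "subspace F"
    and "\<forall>K' \<in> affine_F_images F K. K' \<subseteq> L \<longrightarrow> measure lebesgue K' \<le> measure lebesgue K"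
    and "proj_onto F ` K \<subseteq> L \<inter> F
         \<or> (\<forall>x\<in>K. proj_onto F x - (x - proj_onto F x) \<in> K)"
  shows "\<exists>z \<in> rel_interior (proj_onto F ` K).
           proj_onto F ` ((\<lambda>x. x - z) ` K) \<subseteq> ((\<lambda>x. x - z) ` L) \<inter> F
         \<and> ((\<lambda>x. x - z) ` L) \<inter> F \<subseteq> (\<lambda>x. - real DIM('a) *\<^sub>R x) ` (proj_onto F ` ((\<lambda>x. x - z) ` K))"
proof -
  let ?P = "proj_onto F" and ?d = "real DIM('a)"
  note lin = linear_proj_onto[OF \<open>subspace F\<close>]
  have K: "convex K" and L: "convex L"
    using assms(1,2) by (auto simp: convex_body_def)
  have "0 \<in> K" "0 \<in> L"
    using assms(3,5) interior_subset by blast+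
  have PF: "?P x \<in> F" for x
    using assms(6) by (rule proj_onto_mem)
  \<comment> \<open>The symmetric case reduces to the other one: \<open>?P x\<close> is the midpoint
    of \<open>x\<close> and its reflection, both in \<open>K\<close>.\<close>
  have PKL: "?P ` K \<subseteq> L"
    using assms(8)
  proof
    assume refl: "\<forall>x\<in>K. ?P x - (x - ?P x) \<in> K"
    have "?P x \<in> K" if "x \<in> K" for x
    proof -
      have "?P x = (1 / 2) *\<^sub>R x + (1 / 2) *\<^sub>R (?P x - (x - ?P x))"
        by (simp add: algebra_simps flip: scaleR_add_left)
      then show ?thesis
        using convexD[OF K that bspec[OF refl that], of "1/2" "1/2"] by simp
    qed
    with assms(5) show ?thesis by blast
  qed blast
  obtain u where u: "\<And>x. x \<in> L \<inter> F \<Longrightarrow> u - (1 / ?d) *\<^sub>R x \<in> ?P ` K"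
    using exists_translate_of_largest_volume[OF assms(6,1) L \<open>0 \<in> K\<close> assms(5,7)] by blast
  have "u \<in> ?P ` K"
    using u[of 0] \<open>0 \<in> L\<close> subspace_0[OF assms(6)] by simp
  \<comment> \<open>This is \<open>?d / (?d + 1)\<close> times \<open>u\<close>, the solution of
    \<open>?d *\<^sub>R (u - z) = z\<close>, which the second inclusion requires. Written as a
    shrinking of \<open>u\<close> towards the relative interior point 0, it visibly lies in the
    relative interior.\<close>
  define z where "z = u - (1 / (?d + 1)) *\<^sub>R u"
  have "0 \<in> ?P ` rel_interior K"
    using assms(3) interior_subset_rel_interior linear_0[OF lin] by (metis image_eqI subsetD)
  then have "0 \<in> rel_interior (?P ` K)"
    using rel_interior_convex_linear_image[OF lin K] by simp
  from rel_interior_convex_shrink[OF convex_linear_image[OF lin K] this \<open>u \<in> ?P ` K\<close>, of "1 / (?d + 1)"]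
  have z: "z \<in> rel_interior (?P ` K)"
    by (simp add: z_def)
  then have "z \<in> F"
    using rel_interior_subset PF by blast
  have P_shift: "?P ` (\<lambda>x. x - z) ` K = (\<lambda>q. q - z) ` ?P ` K"
    using proj_onto_eq_self[OF assms(6) \<open>z \<in> F\<close>] by (simp add: image_image linear_diff[OF lin])
  show ?thesis
  proof (intro bexI[OF _ z] conjI)
    show "?P ` (\<lambda>x. x - z) ` K \<subseteq> (\<lambda>x. x - z) ` L \<inter> F"
      unfolding P_shift using PKL PF \<open>z \<in> F\<close> assms(6) by (auto intro: subspace_diff)
    show "(\<lambda>x. x - z) ` L \<inter> F \<subseteq> (\<lambda>x. - ?d *\<^sub>R x) ` ?P ` (\<lambda>x. x - z) ` K"
    proof
      fix y assume "y \<in> (\<lambda>x. x - z) ` L \<inter> F"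
      then obtain x where x: "x \<in> L" "y = x - z" "y \<in> F" by blast
      then have "x \<in> F"
        using subspace_add[OF assms(6) \<open>y \<in> F\<close> \<open>z \<in> F\<close>] by simp
      let ?q = "u - (1 / ?d) *\<^sub>R x"
      have "?d *\<^sub>R (u - z) = z"
      proof -
        have "?d * (1 / (?d + 1)) = 1 - 1 / (?d + 1)"
          by (simp add: field_simps)
        then have "?d *\<^sub>R (u - z) = (1 - 1 / (?d + 1)) *\<^sub>R u"
          by (simp add: z_def)
        then show ?thesis by (simp add: z_def scaleR_diff_left)
      qed
      then have "y = - ?d *\<^sub>R (?q - z)"
        using x(2) by (simp add: algebra_simps)
      moreover have "?q \<in> ?P ` K"
        using u x(1) \<open>x \<in> F\<close> by blast
      ultimately show "y \<in> (\<lambda>x. - ?d *\<^sub>R x) ` ?P ` (\<lambda>x. x - z) ` K"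
        unfolding P_shift by blast
    qed
  qed
qed

end
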